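(* Let $s\ge r\ge 1$ be integers and $0<\delta<1$. Then \[ \mathbf{RT}_s(n,K_{s+r},n^\delta)< \begin{cases} n^{2-\frac{(1-\delta)^2}{r-\delta}}, & \text{if } \frac{r-\delta}{1-\delta} \text{ is an integer},\\[2pt] n^{2-\frac{(1-\delta)^2}{r+1-2\delta}}, & \text{otherwise}. \end{cases} \]
   Context: For a graph $G$ and integer $s\ge 2$, the $s$-independence number $\alpha_s(G)$ is the maximum number of vertices of an induced subgraph of $G$ containing no copy of $K_s$ (for $s=1$, $\alpha_1(G)=0$). For a graph $H$ and a function $f=f(n)$, the Ramsey–Turán number $\mathbf{RT}_s(n,H,f)$ is the maximum number of edges of an $H$-free graph $G$ on $n$ vertices with $\alpha_s(G)<f$; if no such graph exists, $\mathbf{RT}_s(n,H,f)=0$. Rounding of non-integer quantities is ignored. *)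

theory Defs
  imports Complex_Main "HOL-Library.Ramsey"
begin

text \<open>Finite simple graphs are pairs of a vertex set and a set of two-element edges;
  \<open>[V]\<^bsup>2\<^esup>\<close> is the set of two-element subsets of \<open>V\<close>.\<close>

type_synonym 'a graph = "'a set \<times> 'a set set"

abbreviation verts :: "'a graph \<Rightarrow> 'a set" where "verts \<equiv> fst"

abbreviation edges :: "'a graph \<Rightarrow> 'a set set" where "edges \<equiv> snd"

definition simple_graph :: "'a graph \<Rightarrow> bool" where
  "simple_graph G \<longleftrightarrow> finite (verts G) \<and> edges G \<subseteq> [verts G]\<^bsup>2\<^esup>"

definition complete_graph :: "nat \<Rightarrow> nat graph" where
  "complete_graph k = ({..<k}, [{..<k}]\<^bsup>2\<^esup>)"

definition induced :: "'a graph \<Rightarrow> 'a set \<Rightarrow> 'a graph" where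
  "induced G S = (S, {e \<in> edges G. e \<subseteq> S})"

text \<open>A copy is a not necessarily induced subgraph.\<close>

definition contains_copy :: "'a graph \<Rightarrow> 'b graph \<Rightarrow> bool" where
  "contains_copy G H \<longleftrightarrow>
     (\<exists>\<phi>. inj_on \<phi> (verts H) \<and> \<phi> ` verts H \<subseteq> verts G \<and> (\<forall>e\<in>edges H. \<phi> ` e \<in> edges G))"

text \<open>For \<open>s = 1\<close> only the empty set of vertices qualifies, which gives the convention that the
  \<open>1\<close>-independence number is \<open>0\<close> (lemma \<open>indep_number_1\<close>). The case \<open>s = 0\<close> carries no meaning.\<close>

definition indep_number :: "nat \<Rightarrow> 'a graph \<Rightarrow> nat" where
  "indep_number s G =
     Max {card S | S. S \<subseteq> verts G \<and> \<not> contains_copy (induced G S) (complete_graph s)}"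

definition ramsey_turan_graph :: "nat \<Rightarrow> nat \<Rightarrow> 'b graph \<Rightarrow> (nat \<Rightarrow> real) \<Rightarrow> 'a graph \<Rightarrow> bool" where
  "ramsey_turan_graph s n H f G \<longleftrightarrow>
     simple_graph G \<and> card (verts G) = n \<and> \<not> contains_copy G H \<and> real (indep_number s G) < f n"

text \<open>Every finite graph is isomorphic to one whose vertices are natural numbers, so the maximum is
  taken over those.\<close>

definition RT :: "nat \<Rightarrow> nat \<Rightarrow> 'b graph \<Rightarrow> (nat \<Rightarrow> real) \<Rightarrow> nat" where
  "RT s n H f =
     (if \<exists>G :: nat graph. ramsey_turan_graph s n H f G
      then Max {card (edges G) | G :: nat graph. ramsey_turan_graph s n H f G}
      else 0)"

text \<open>The following facts show that both maxima are over finite sets, the first of which is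
  nonempty for \<open>s \<ge> 1\<close>.\<close>

lemma finite_indep_number_set:
  assumes "simple_graph G"
  shows "finite {card S | S. S \<subseteq> verts G \<and> \<not> contains_copy (induced G S) (complete_graph s)}"
proof (rule finite_subset)
  show "{card S | S. S \<subseteq> verts G \<and> \<not> contains_copy (induced G S) (complete_graph s)}
          \<subseteq> card ` Pow (verts G)"
    by auto
qed (use assms in \<open>simp add: simple_graph_def\<close>)

lemma indep_number_set_nonempty:
  assumes "s \<ge> 1"
  shows "{card S | S. S \<subseteq> verts G \<and> \<not> contains_copy (induced G S) (complete_graph s)} \<noteq> {}"
proof -
  have "\<not> contains_copy (induced G {}) (complete_graph s)"
    using assms by (auto simp: contains_copy_def induced_def complete_graph_def lessThan_empty_iff)
  then show ?thesis by blast
qed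

lemma indep_number_1: "indep_number 1 G = 0"
proof -
  have "contains_copy (induced G S) (complete_graph 1) \<longleftrightarrow> S \<noteq> {}" for S
  proof -
    have "[{0::nat}]\<^bsup>2\<^esup> = {}" by (simp add: nsets_2_eq)
    then show ?thesis
      by (auto simp: contains_copy_def induced_def complete_graph_def lessThan_Suc)
  qed
  then have "{card S | S. S \<subseteq> verts G \<and> \<not> contains_copy (induced G S) (complete_graph 1)} = {0}"
    by auto
  then show ?thesis by (simp add: indep_number_def)
qed

lemma finite_RT_set:
  "finite {card (edges G) | G :: 'a graph. ramsey_turan_graph s n H f G}"
proof (rule finite_subset)
  have "card (edges G) \<le> n choose 2" if "ramsey_turan_graph s n H f G" for G :: "'a graph"
  proof -
    have "finite ([verts G]\<^bsup>2\<^esup>)" "edges G \<subseteq> [verts G]\<^bsup>2\<^esup>" "card (verts G) = n"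
      using that by (auto simp: ramsey_turan_graph_def simple_graph_def finite_imp_finite_nsets)
    then show ?thesis
      by (metis card_mono card_nsets)
  qed
  then show "{card (edges G) | G :: 'a graph. ramsey_turan_graph s n H f G} \<subseteq> {..n choose 2}"
    by auto
qed simp

end

theory Submission
  imports Defs "HOL-Library.FuncSet"
begin

text \<open>Dependent random choice. Pick \<open>t\<close> vertices at random with repetition and let \<open>U\<close> be their
  common neighbourhood. If \<open>G\<close> has at least \<open>n powr (2 - \<epsilon>)\<close> edges, then by convexity the expected
  size of \<open>U\<close> is at least \<open>2 * n powr (1 - \<epsilon> * t)\<close>, whereas the expected number of \<open>r\<close>-subsets of
  \<open>U\<close> with fewer than \<open>n powr \<delta>\<close> common neighbours is at most \<open>n powr (r - (1 - \<delta>) * t)\<close>. If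
  \<open>(r - \<delta>) / (1 - \<delta>) \<le> t \<le> (1 - \<delta>) / \<epsilon>\<close>, deleting a vertex from each such subset leaves at least
  \<open>n powr \<delta>\<close> vertices, and these contain a \<open>K\<^sub>s\<close>. The common neighbourhood of any \<open>r \<le> s\<close> of its
  vertices contains another \<open>K\<^sub>s\<close>, and together they form a \<open>K\<^bsub>s+r\<^esub>\<close>. The two cases of the
  theorem are \<open>t = (r - \<delta>) / (1 - \<delta>)\<close> and its ceiling.\<close>

section \<open>Common neighbourhoods and cliques\<close>

definition common_nbrs :: "'a graph \<Rightarrow> 'a set \<Rightarrow> 'a set" where
  "common_nbrs G S = {u \<in> verts G. \<forall>v\<in>S. {u, v} \<in> edges G}"

text \<open>Adjacency is symmetric. This swap lets the tuples whose common neighbourhood contains a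
  given set be counted.\<close>

lemma subset_common_nbrs_commute:
  assumes "S \<subseteq> verts G" "A \<subseteq> verts G"
  shows "S \<subseteq> common_nbrs G A \<longleftrightarrow> A \<subseteq> common_nbrs G S"
proof -
  have "{u, v} \<in> edges G \<longleftrightarrow> {v, u} \<in> edges G" for u v by (simp add: insert_commute)
  then show ?thesis using assms unfolding common_nbrs_def by blast
qed

text \<open>Trades the embedding for its image, so that cliques can be restricted and united as
  sets.\<close>

lemma contains_copy_complete_graph_iff:
  "contains_copy G (complete_graph k) \<longleftrightarrow> (\<exists>K\<in>[verts G]\<^bsup>k\<^esup>. [K]\<^bsup>2\<^esup> \<subseteq> edges G)"
proof
  assume "contains_copy G (complete_graph k)"
  then obtain \<phi> where \<phi>: "inj_on \<phi> {..<k}" "\<phi> ` {..<k} \<subseteq> verts G"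
      "\<And>e. e \<in> [{..<k}]\<^bsup>2\<^esup> \<Longrightarrow> \<phi> ` e \<in> edges G"
    by (auto simp: contains_copy_def complete_graph_def)
  have "\<phi> ` {..<k} \<in> [verts G]\<^bsup>k\<^esup>"
    using \<phi> by (simp add: nsets_def card_image)
  moreover have "[\<phi> ` {..<k}]\<^bsup>2\<^esup> \<subseteq> edges G"
  proof
    fix e assume "e \<in> [\<phi> ` {..<k}]\<^bsup>2\<^esup>"
    then obtain i j where "i < k" "j < k" "e = {\<phi> i, \<phi> j}" "\<phi> i \<noteq> \<phi> j"
      by (auto simp: nsets_2_eq)
    then show "e \<in> edges G"
      using \<phi>(3)[of "{i, j}"] by (auto simp: nsets_2_eq)
  qed
  ultimately show "\<exists>K\<in>[verts G]\<^bsup>k\<^esup>. [K]\<^bsup>2\<^esup> \<subseteq> edges G"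
    by blast
next
  assume "\<exists>K\<in>[verts G]\<^bsup>k\<^esup>. [K]\<^bsup>2\<^esup> \<subseteq> edges G"
  then obtain K where K: "K \<subseteq> verts G" "finite K" "card K = k" "[K]\<^bsup>2\<^esup> \<subseteq> edges G"
    by (auto simp: nsets_def)
  then obtain \<phi> where \<phi>: "bij_betw \<phi> {..<k} K"
    by (metis bij_betw_from_nat_into_finite)
  have "\<phi> ` e \<in> edges G" if "e \<in> [{..<k}]\<^bsup>2\<^esup>" for e
  proof -
    have "\<phi> ` e \<in> [K]\<^bsup>2\<^esup>"
      using that \<phi> by (auto simp: nsets_def bij_betw_def card_image inj_on_subset)
    then show ?thesis using K by blast
  qed
  then show "contains_copy G (complete_graph k)"
    using \<phi> K unfolding contains_copy_def complete_graph_def bij_betw_def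
    by (intro exI[of _ \<phi>]) auto
qed

lemma clique_in_large_set:
  assumes G: "simple_graph G" and S: "S \<subseteq> verts G" and "indep_number s G < card S"
  obtains K where "K \<in> [S]\<^bsup>s\<^esup>" "[K]\<^bsup>2\<^esup> \<subseteq> edges G"
proof -
  have "contains_copy (induced G S) (complete_graph s)"
  proof (rule ccontr)
    assume "\<not> contains_copy (induced G S) (complete_graph s)"
    then have "card S \<le> indep_number s G"
      unfolding indep_number_def
      using S by (intro Max_ge finite_indep_number_set G) blast
    then show False using assms by simp
  qed
  then show ?thesis
    using that by (auto simp: contains_copy_complete_graph_iff induced_def)
qed

section \<open>Double counting and averaging\<close>

lemma sum_degrees:
  assumes "simple_graph G"
  shows "(\<Sum>v\<in>verts G. card (common_nbrs G {v})) = 2 * card (edges G)"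
proof -
  have fin: "finite (verts G)" and E: "edges G \<subseteq> [verts G]\<^bsup>2\<^esup>"
    using assms by (auto simp: simple_graph_def)
  then have finE: "finite (edges G)"
    by (meson finite_imp_finite_nsets finite_subset)
  have "card (common_nbrs G {v}) = card {e \<in> edges G. v \<in> e}" for v
  proof (rule bij_betw_same_card)
    show "bij_betw (\<lambda>u. {u, v}) (common_nbrs G {v}) {e \<in> edges G. v \<in> e}"
      unfolding bij_betw_def
    proof (intro conjI subset_antisym subsetI)
      show "inj_on (\<lambda>u. {u, v}) (common_nbrs G {v})"
        by (auto simp: inj_on_def doubleton_eq_iff)
    next
      fix e assume e: "e \<in> {e \<in> edges G. v \<in> e}"
      then obtain x y where "e = {x, y}" "x \<in> verts G" "y \<in> verts G"
        using E by (fastforce simp: nsets_2_eq)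
      then show "e \<in> (\<lambda>u. {u, v}) ` common_nbrs G {v}"
        using e by (auto simp: common_nbrs_def insert_commute)
    qed (auto simp: common_nbrs_def)
  qed
  then have "(\<Sum>v\<in>verts G. card (common_nbrs G {v})) = (\<Sum>v\<in>verts G. card {e \<in> edges G. v \<in> e})"
    by simp
  also have "\<dots> = 2 * card (edges G)"
  proof (rule sum_multicount)
    show "\<forall>e\<in>edges G. card {v \<in> verts G. v \<in> e} = 2"
    proof
      fix e assume "e \<in> edges G"
      then have "{v \<in> verts G. v \<in> e} = e" "card e = 2"
        using E by (auto simp: nsets_def)
      then show "card {v \<in> verts G. v \<in> e} = 2" by simp
    qed
  qed (use fin finE in auto)
  finally show ?thesis .
qed

text \<open>With \<open>a\<close> the mean, Bernoulli's inequality for \<open>d x / a\<close> gives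
  the tangent line to the \<open>t\<close>-th power at \<open>a\<close>. Summed over
  \<open>A\<close>, the linear terms cancel.\<close>

lemma power_mean_le_sum:
  fixes d :: "'a \<Rightarrow> real"
  assumes "finite A" "\<And>x. x \<in> A \<Longrightarrow> 0 \<le> d x"
  shows "real (card A) * (sum d A / real (card A)) ^ t \<le> (\<Sum>x\<in>A. d x ^ t)"
proof -
  define a where "a = sum d A / real (card A)"
  have "0 \<le> a" unfolding a_def by (simp add: assms sum_nonneg)
  show ?thesis
  \<comment> \<open>The case \<open>a = 0\<close> includes empty \<open>A\<close>, where division by
    zero gives 0. It needs a split on \<open>t\<close> because \<open>0 ^ 0 = 1\<close>.\<close>
  proof (cases "a = 0")
    case True
    then show ?thesis
      unfolding a_def[symmetric]
      using assms by (cases t) (auto intro: sum_nonneg)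
  next
    case False
    with \<open>0 \<le> a\<close> have a: "0 < a" by simp
    then have "card A \<noteq> 0" by (intro notI) (simp add: a_def)
    have "a ^ t * (1 + real t * (d x / a - 1)) \<le> d x ^ t" if "x \<in> A" for x
    proof -
      have "1 + real t * (d x / a - 1) \<le> (1 + (d x / a - 1)) ^ t"
        using a assms(2)[OF that] by (intro Bernoulli_inequality) simp
      then have "a ^ t * (1 + real t * (d x / a - 1)) \<le> a ^ t * (d x / a) ^ t"
        using a by (intro mult_left_mono) auto
      then show ?thesis
        using a by (simp add: power_divide)
    qed
    then have "(\<Sum>x\<in>A. a ^ t * (1 + real t * (d x / a - 1))) \<le> (\<Sum>x\<in>A. d x ^ t)"
      by (rule sum_mono)
    moreover have "(\<Sum>x\<in>A. 1 + real t * (d x / a - 1)) = real (card A)"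
    proof -
      have "sum d A / a = real (card A)"
        using a \<open>card A \<noteq> 0\<close> by (auto simp: a_def)
      then show ?thesis
        by (simp add: sum.distrib sum_subtractf flip: sum_distrib_left sum_divide_distrib)
    qed
    ultimately show ?thesis
      unfolding a_def[symmetric] by (simp add: mult.commute flip: sum_distrib_left)
  qed
qed

text \<open>By the swap above, the tuples in question are exactly those with all entries in
  \<open>common_nbrs G S\<close>. Repetition is allowed, so their number is an exact power.\<close>

lemma card_tuples_with_common_nbrs_containing:
  assumes "finite (verts G)"
  shows "card {T \<in> {..<t} \<rightarrow>\<^sub>E verts G. S \<subseteq> common_nbrs G (T ` {..<t})} =
    (if S \<subseteq> verts G then card (common_nbrs G S) ^ t else 0)"
proof (cases "S \<subseteq> verts G")
  case True
  have "{T \<in> {..<t} \<rightarrow>\<^sub>E verts G. S \<subseteq> common_nbrs G (T ` {..<t})} = {..<t} \<rightarrow>\<^sub>E common_nbrs G S"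
  proof (intro set_eqI iffI)
    fix T assume T: "T \<in> {T \<in> {..<t} \<rightarrow>\<^sub>E verts G. S \<subseteq> common_nbrs G (T ` {..<t})}"
    then have "T ` {..<t} \<subseteq> common_nbrs G S"
      using True subset_common_nbrs_commute[of S G "T ` {..<t}"] by fastforce
    then show "T \<in> {..<t} \<rightarrow>\<^sub>E common_nbrs G S"
      using T unfolding PiE_iff by blast
  next
    fix T assume T: "T \<in> {..<t} \<rightarrow>\<^sub>E common_nbrs G S"
    then have "T ` {..<t} \<subseteq> common_nbrs G S" by fastforce
    moreover from this have "T ` {..<t} \<subseteq> verts G" by (auto simp: common_nbrs_def)
    ultimately show "T \<in> {T \<in> {..<t} \<rightarrow>\<^sub>E verts G. S \<subseteq> common_nbrs G (T ` {..<t})}"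
      using T True subset_common_nbrs_commute[of S G "T ` {..<t}"] unfolding PiE_iff by blast
  qed
  then show ?thesis
    using True by (simp add: card_funcsetE)
next
  case False
  then have "\<not> S \<subseteq> common_nbrs G A" for A by (auto simp: common_nbrs_def)
  then show ?thesis using False by simp
qed

text \<open>Expectations are multiplied by the number \<open>n ^ t\<close> of tuples and become
  plain sums. Hypothesis \<open>le\<close> says that the lower bound for the total size of the sets
  \<open>W T\<close> exceeds the upper bound for the total number of bad sets by at least
  \<open>a * n ^ t\<close>.\<close>

lemma dependent_random_choice:
  fixes G :: "'a graph" and a m :: real
  defines "n \<equiv> card (verts G)"
  assumes G: "simple_graph G" and n: "1 \<le> n" and r: "1 \<le> r" and m: "0 \<le> m"
    and le: "a * real n ^ t + real n ^ r * m ^ t \<le> real n * (2 * real (card (edges G)) / real n) ^ t"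
  obtains U where "U \<subseteq> verts G" "a \<le> real (card U)"
    "\<And>S. S \<in> [U]\<^bsup>r\<^esup> \<Longrightarrow> m \<le> real (card (common_nbrs G S))"
proof -
  let ?V = "verts G"
  define \<T> where "\<T> = {..<t} \<rightarrow>\<^sub>E ?V"
  define W where "W = (\<lambda>T :: nat \<Rightarrow> 'a. common_nbrs G (T ` {..<t}))"
  define B where "B = {S \<in> [?V]\<^bsup>r\<^esup>. real (card (common_nbrs G S)) < m}"
  define bad where "bad = (\<lambda>T. {S \<in> B. S \<subseteq> W T})"
  have fin: "finite ?V" using G by (simp add: simple_graph_def)
  have fin\<T>: "finite \<T>" unfolding \<T>_def using fin by (simp add: finite_PiE)
  have finB: "finite B" unfolding B_def using fin by (simp add: finite_imp_finite_nsets)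
  have WV: "W T \<subseteq> ?V" for T by (auto simp: W_def common_nbrs_def)
  have card\<T>: "card \<T> = n ^ t" unfolding \<T>_def n_def by (simp add: card_funcsetE)

  have "real n * (2 * real (card (edges G)) / real n) ^ t
      \<le> (\<Sum>v\<in>?V. real (card (common_nbrs G {v})) ^ t)"
    using power_mean_le_sum[OF fin, of "\<lambda>v. real (card (common_nbrs G {v}))" t] sum_degrees[OF G]
    by (simp add: n_def flip: of_nat_sum)
  also have "\<dots> = real (\<Sum>v\<in>?V. card {T \<in> \<T>. v \<in> W T})"
    using card_tuples_with_common_nbrs_containing[OF fin, where t = t, of "{_}"]
    by (simp add: \<T>_def W_def)
  also have "(\<Sum>v\<in>?V. card {T \<in> \<T>. v \<in> W T}) = (\<Sum>T\<in>\<T>. card {v \<in> ?V. v \<in> W T})"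
    by (rule sum_multicount_gen[symmetric]) (use fin fin\<T> in auto)
  also have "\<dots> = (\<Sum>T\<in>\<T>. card (W T))"
    using WV by (intro sum.cong refl arg_cong[where f = card]) blast
  finally have lower: "real n * (2 * real (card (edges G)) / real n) ^ t
      \<le> (\<Sum>T\<in>\<T>. real (card (W T)))" by simp

  \<comment> \<open>Counted from the other side, a set \<open>S\<close> in \<open>B\<close> is bad
    for \<open>card (common_nbrs G S) ^ t\<close> tuples, which is at most
    \<open>m ^ t\<close>.\<close>
  have "(\<Sum>T\<in>\<T>. real (card (bad T))) = real (\<Sum>S\<in>B. card {T \<in> \<T>. S \<subseteq> W T})"
    unfolding bad_def of_nat_sum[symmetric]
    by (intro arg_cong[where f = real] sum_multicount_gen) (use finB fin\<T> in auto)
  also have "\<dots> = (\<Sum>S\<in>B. real (card (common_nbrs G S)) ^ t)"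
    using card_tuples_with_common_nbrs_containing[OF fin, where t = t]
    by (simp add: \<T>_def W_def B_def nsets_def)
  also have "\<dots> \<le> real (card B) * m ^ t"
    by (intro sum_bounded_above power_mono) (auto simp: B_def)
  also have "\<dots> \<le> real n ^ r * m ^ t"
  proof (intro mult_right_mono)
    have "card B \<le> card ([?V]\<^bsup>r\<^esup>)"
      using fin by (intro card_mono) (auto simp: B_def finite_imp_finite_nsets)
    also have "\<dots> \<le> n ^ r"
      by (cases "r \<le> n") (simp_all add: n_def binomial_le_pow binomial_eq_0)
    finally show "real (card B) \<le> real n ^ r" by (metis of_nat_le_iff of_nat_power)
  qed (use m in simp)
  finally have upper: "(\<Sum>T\<in>\<T>. real (card (bad T))) \<le> real n ^ r * m ^ t" .

  have "\<exists>T\<in>\<T>. a \<le> real (card (W T)) - real (card (bad T))"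
  proof (rule ccontr)
    assume "\<not> ?thesis"
    \<comment> \<open>Strictness uses that some tuple exists, which follows from
      \<open>1 \<le> n\<close>.\<close>
    then have "(\<Sum>T\<in>\<T>. real (card (W T)) - real (card (bad T))) < (\<Sum>T\<in>\<T>. a)"
      using fin\<T> card\<T> n by (intro sum_strict_mono) auto
    then show False
      using lower upper le card\<T> by (simp add: sum_subtractf mult.commute)
  qed
  then obtain T where T: "a \<le> real (card (W T)) - real (card (bad T))" by blast
  \<comment> \<open>Bad sets are nonempty since \<open>1 \<le> r\<close>, so each supplies a vertex
    \<open>c S\<close> to delete.\<close>
  have "\<exists>v. v \<in> S" if "S \<in> bad T" for S
    using that r by (intro ex_in_conv[THEN iffD2] notI) (simp add: bad_def B_def nsets_def)
  then obtain c where c: "\<And>S. S \<in> bad T \<Longrightarrow> c S \<in> S" by metis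
  show ?thesis
  proof
    show "W T - c ` bad T \<subseteq> ?V" using WV by blast
    have "finite (bad T)" using finB by (simp add: bad_def)
    then have "card (W T) - card (bad T) \<le> card (W T - c ` bad T)"
      by (meson card_image_le diff_card_le_card_Diff diff_le_mono2 finite_imageI order_trans)
    then show "a \<le> real (card (W T - c ` bad T))" using T by linarith
  next
    fix S assume S: "S \<in> [W T - c ` bad T]\<^bsup>r\<^esup>"
    show "m \<le> real (card (common_nbrs G S))"
    proof (rule ccontr)
      assume "\<not> ?thesis"
      then have "S \<in> bad T"
        using S WV[of T] by (auto simp: bad_def B_def nsets_def)
      then show False using c S by (fastforce simp: nsets_def)
    qed
  qed
qed

section \<open>From the chosen set to a clique and an edge bound\<close>

lemma clique_join_common_nbrs:
  assumes G: "simple_graph G"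
    and K: "K \<in> [verts G]\<^bsup>s\<^esup>" "[K]\<^bsup>2\<^esup> \<subseteq> edges G"
    and L: "L \<in> [common_nbrs G K]\<^bsup>r\<^esup>" "[L]\<^bsup>2\<^esup> \<subseteq> edges G"
  shows "contains_copy G (complete_graph (s + r))"
proof -
  have edge: "{u, v} \<in> edges G" if "u \<in> L" "v \<in> K" for u v
    using L that by (auto simp: nsets_def common_nbrs_def)
  \<comment> \<open>A vertex in both \<open>K\<close> and \<open>L\<close> would be adjacent to
    itself by \<open>edge\<close>.\<close>
  have "{u} \<notin> edges G" for u
    using G by (auto simp: simple_graph_def nsets_def)
  with edge have "K \<inter> L = {}" by fastforce
  then have "K \<union> L \<in> [verts G]\<^bsup>(s + r)\<^esup>"
    using K L by (auto simp: nsets_def common_nbrs_def card_Un_disjoint)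
  moreover have "[K \<union> L]\<^bsup>2\<^esup> \<subseteq> edges G"
  proof
    fix e assume "e \<in> [K \<union> L]\<^bsup>2\<^esup>"
    then obtain u v where e: "e = {u, v}" "u \<in> K \<union> L" "v \<in> K \<union> L" "u \<noteq> v"
      by (auto simp: nsets_2_eq)
    have "e \<in> [K]\<^bsup>2\<^esup>" if "u \<in> K" "v \<in> K" using e that by (auto simp: nsets_2_eq)
    moreover have "e \<in> [L]\<^bsup>2\<^esup>" if "u \<in> L" "v \<in> L" using e that by (auto simp: nsets_2_eq)
    ultimately show "e \<in> edges G"
      using e edge[of u v] edge[of v u] K(2) L(2) by (auto simp: insert_commute)
  qed
  ultimately show ?thesis
    unfolding contains_copy_complete_graph_iff by blast
qed

text \<open>Dependent random choice is applied with \<open>a\<close> and \<open>m\<close> both equal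
  to \<open>n powr \<delta>\<close>. Then \<open>t_lower\<close> says
  \<open>r + \<delta> * t \<le> \<delta> + t\<close>, so the bad sets cost no more than the first
  term, and \<open>t_upper\<close> says
  \<open>\<delta> + t \<le> 1 + (1 - \<epsilon>) * t\<close>.\<close>

lemma ramsey_turan_graph_few_edges:
  fixes \<delta> \<epsilon> :: real
  assumes rt: "ramsey_turan_graph s n (complete_graph (s + r)) (\<lambda>m. real m powr \<delta>) G"
    and r: "1 \<le> r" "r \<le> s" and n: "1 \<le> n" and t: "1 \<le> t"
    and t_lower: "real r - \<delta> \<le> (1 - \<delta>) * real t" and t_upper: "\<epsilon> * real t \<le> 1 - \<delta>"
  shows "real (card (edges G)) < real n powr (2 - \<epsilon>)"
proof (rule ccontr)
  let ?m = "real n powr \<delta>"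
  assume "\<not> ?thesis"
  then have e: "real n powr (2 - \<epsilon>) \<le> real (card (edges G))" by simp
  have G: "simple_graph G" and card: "card (verts G) = n"
    and free: "\<not> contains_copy G (complete_graph (s + r))" and ind: "real (indep_number s G) < ?m"
    using rt by (auto simp: ramsey_turan_graph_def)
  have rn: "1 \<le> real n" using n by simp
  have "?m * real n ^ t + real n ^ r * ?m ^ t
      = real n powr (\<delta> + real t) + real n powr (real r + \<delta> * real t)"
    using rn by (simp add: powr_add powr_realpow powr_powr[symmetric])
  also have "\<dots> \<le> 2 * real n powr (\<delta> + real t)"
    using rn t_lower powr_mono[of "real r + \<delta> * real t" "\<delta> + real t" "real n"]
    by (simp add: algebra_simps)
  also have "\<dots> \<le> 2 ^ t * real n powr (1 + (1 - \<epsilon>) * real t)"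
  proof (intro mult_mono powr_mono)
    \<comment> \<open>The 2 from merging the two terms is absorbed by the 2 in the average degree,
      raised to the power \<open>t\<close>.\<close>
    show "(2::real) \<le> 2 ^ t" using t power_increasing[of 1 t "2::real"] by simp
  qed (use rn t_upper in \<open>simp_all add: algebra_simps\<close>)
  also have "\<dots> = real n * (2 * real n powr (1 - \<epsilon>)) ^ t"
    using rn by (simp add: powr_add powr_realpow powr_powr[symmetric] power_mult_distrib)
  also have "\<dots> \<le> real n * (2 * real (card (edges G)) / real n) ^ t"
  proof (intro mult_left_mono power_mono)
    have "real n powr (1 - \<epsilon>) = real n powr (2 - \<epsilon>) / real n"
      using rn powr_diff[of "real n" "2 - \<epsilon>" 1] by simp
    then show "2 * real n powr (1 - \<epsilon>) \<le> 2 * real (card (edges G)) / real n"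
      using e rn by (simp add: divide_right_mono)
  qed simp_all
  finally obtain U where U: "U \<subseteq> verts G" "?m \<le> real (card U)"
      "\<And>S. S \<in> [U]\<^bsup>r\<^esup> \<Longrightarrow> ?m \<le> real (card (common_nbrs G S))"
    using dependent_random_choice[OF G, of r ?m ?m t] n r card by auto
  then have "indep_number s G < card U" using ind by linarith
  then obtain K where K: "K \<in> [U]\<^bsup>s\<^esup>" "[K]\<^bsup>2\<^esup> \<subseteq> edges G"
    using clique_in_large_set[OF G U(1)] by blast
  obtain L where L: "L \<subseteq> K" "card L = r" "finite L"
    using K r obtain_subset_with_card_n[of r K] by (auto simp: nsets_def)
  then have "L \<in> [U]\<^bsup>r\<^esup>" using K by (auto simp: nsets_def)
  then have "indep_number s G < card (common_nbrs G L)" using U(3)[of L] ind by linarith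
  then obtain M where M: "M \<in> [common_nbrs G L]\<^bsup>s\<^esup>" "[M]\<^bsup>2\<^esup> \<subseteq> edges G"
    using clique_in_large_set[OF G, of "common_nbrs G L"] by (auto simp: common_nbrs_def)
  have "[L]\<^bsup>2\<^esup> \<subseteq> edges G" using K(2) nsets_mono[OF L(1)] by blast
  moreover have "L \<in> [verts G]\<^bsup>r\<^esup>" using \<open>L \<in> [U]\<^bsup>r\<^esup>\<close> nsets_mono[OF U(1)] by blast
  \<comment> \<open>Here \<open>L\<close> is the base of the join and \<open>M\<close> the clique in
    its common neighbourhood.\<close>
  ultimately have "contains_copy G (complete_graph (r + s))"
    using clique_join_common_nbrs[OF G _ _ M] by blast
  then show False using free by (simp add: add.commute)
qed

lemma RT_less:
  fixes \<delta> \<epsilon> :: real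
  assumes "1 \<le> r" "r \<le> s" "1 \<le> n" "1 \<le> t"
    and "real r - \<delta> \<le> (1 - \<delta>) * real t" and "\<epsilon> * real t \<le> 1 - \<delta>"
  shows "real (RT s n (complete_graph (s + r)) (\<lambda>m. real m powr \<delta>)) < real n powr (2 - \<epsilon>)"
proof -
  let ?rt = "ramsey_turan_graph s n (complete_graph (s + r)) (\<lambda>m. real m powr \<delta>)"
  show ?thesis
  proof (cases "\<exists>G :: nat graph. ?rt G")
    case True
    then have "RT s n (complete_graph (s + r)) (\<lambda>m. real m powr \<delta>)
        \<in> {card (edges G) | G :: nat graph. ?rt G}"
      unfolding RT_def by (simp only: if_True) (rule Max_in, rule finite_RT_set, blast)
    then obtain G :: "nat graph" where "?rt G"
        "RT s n (complete_graph (s + r)) (\<lambda>m. real m powr \<delta>) = card (edges G)"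
      by blast
    then show ?thesis
      using ramsey_turan_graph_few_edges assms by metis
  next
    \<comment> \<open>The default value 0 is below the bound, a positive power as
      \<open>1 \<le> n\<close>.\<close>
    case False
    then show ?thesis using assms by (simp add: RT_def)
  qed
qed

theorem theorem5p3:
  fixes s r n :: nat and \<delta> :: real
  assumes "s \<ge> r" and "r \<ge> 1" and "n \<ge> 1" and "0 < \<delta>" and "\<delta> < 1"
  shows "real (RT s n (complete_graph (s + r)) (\<lambda>m. real m powr \<delta>)) <
    (if (real r - \<delta>) / (1 - \<delta>) \<in> \<int>
     then real n powr (2 - (1 - \<delta>)\<^sup>2 / (real r - \<delta>))
     else real n powr (2 - (1 - \<delta>)\<^sup>2 / (real r + 1 - 2 * \<delta>)))"
proof -
  \<comment> \<open>\<open>x\<close> is the least real exponent that the lower condition on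
    \<open>t\<close> allows. For a given \<open>t\<close> the best \<open>\<epsilon>\<close> is
    \<open>(1 - \<delta>) / t\<close>. Since \<open>1 \<le> x\<close>, passing to \<open>nat\<close>
    loses nothing.\<close>
  define x where "x = (real r - \<delta>) / (1 - \<delta>)"
  define t where "t = nat \<lceil>x\<rceil>"
  have x: "1 \<le> x" using assms by (simp add: x_def)
  then have t: "1 \<le> t" "x \<le> real t" "real t \<le> x + 1" unfolding t_def by linarith+
  have r_eq: "real r - \<delta> = (1 - \<delta>) * x" and r_eq': "real r + 1 - 2 * \<delta> = (1 - \<delta>) * (x + 1)"
    using assms by (simp_all add: x_def field_simps)
  have lower: "real r - \<delta> \<le> (1 - \<delta>) * real t"
    unfolding r_eq using assms t by (intro mult_left_mono) auto
  show ?thesis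
  proof (cases "x \<in> \<int>")
    case True
    then have "real t = x" using x by (auto simp: t_def elim!: Ints_cases)
    then have "(1 - \<delta>)\<^sup>2 / (real r - \<delta>) * real t \<le> 1 - \<delta>"
      unfolding r_eq using x assms by (simp add: power2_eq_square)
    from RT_less[OF assms(2,1,3) t(1) lower this] show ?thesis
      using True by (simp add: x_def)
  next
    case False
    \<comment> \<open>The ceiling is only bounded by \<open>x + 1\<close>, so
      \<open>\<epsilon>\<close> is \<open>(1 - \<delta>) / (x + 1)\<close>.\<close>
    have "(1 - \<delta>)\<^sup>2 / (real r + 1 - 2 * \<delta>) * real t = (1 - \<delta>) * (real t / (x + 1))"
      unfolding r_eq' using assms by (simp add: power2_eq_square)
    also have "\<dots> \<le> (1 - \<delta>) * 1"
      using x t assms by (intro mult_left_mono) auto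
    finally have "(1 - \<delta>)\<^sup>2 / (real r + 1 - 2 * \<delta>) * real t \<le> 1 - \<delta>" by simp
    from RT_less[OF assms(2,1,3) t(1) lower this] show ?thesis
      using False by (simp add: x_def)
  qed
qed

end
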